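(* For all positive integers $n$, we have $c_\infty(P_n \,\Box\, P_n \,\Box\, P_n) \le (0.75 + o(1))\,n^2$, where $o(1)$ denotes a quantity tending to $0$ as $n \to \infty$.
   Context: The infinite-speed game of Cops and Robbers on a finite graph $G$: there is a team of cops and one robber, each occupying a vertex of $G$ (several cops may share a vertex), with all positions known to both players. The cops first choose their initial positions; then the robber chooses his initial position. The game proceeds in rounds, each consisting of a cop turn followed by a robber turn. On the cops' turn, each cop either stays at her vertex or moves to a neighboring vertex. On the robber's turn, he may stay put or move along any path in $G$ of arbitrary length starting at his current vertex that does not pass through any vertex occupied by a cop. The cops win if at some point some cop occupies the same vertex as the robber; the robber wins if he evades capture forever. The infinite-speed cop number $c_\infty(G)$ is the minimum number of cops that guarantees a win for the cops on $G$ no matter how the robber plays. $P_n$ denotes the path with $n$ vertices and $\Box$ denotes the Cartesian product of graphs. *)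

theory Defs
  imports Complex_Main "Graph_Theory.Graph_Theory"
begin

text \<open>
  A finite simple graph is a \<^locale>\<open>pair_graph\<close>: every edge is represented by its two arcs.
\<close>

definition path_graph :: "nat \<Rightarrow> nat pair_pre_digraph" where
  "path_graph n =
    \<lparr> pverts = {..<n}, parcs = {(i, j). i < n \<and> j < n \<and> (j = Suc i \<or> i = Suc j)} \<rparr>"

definition cartesian_product ::
    "'a pair_pre_digraph \<Rightarrow> 'b pair_pre_digraph \<Rightarrow> ('a \<times> 'b) pair_pre_digraph"
    (infixl "\<box>" 70) where
  "G \<box> H =
    \<lparr> pverts = pverts G \<times> pverts H,
      parcs = {((u, v), (u', v')).
        (u = u' \<and> u \<in> pverts G \<and> (v, v') \<in> parcs H) \<or>
        ((u, u') \<in> parcs G \<and> v = v' \<and> v \<in> pverts H)} \<rparr>"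

lemma pair_graph_path_graph: "pair_graph (path_graph n)"
proof
  show "finite (parcs (path_graph n))"
    by (rule finite_subset[of _ "{..<n} \<times> {..<n}"]) (auto simp: path_graph_def)
qed (auto simp: path_graph_def symmetric_def sym_def)

lemma pair_graph_cartesian_product:
  assumes "pair_graph G" and "pair_graph H"
  shows "pair_graph (G \<box> H)"
proof -
  interpret G: pair_graph G by fact
  interpret H: pair_graph H by fact
  have symG: "(v, u) \<in> parcs G" if "(u, v) \<in> parcs G" for u v
    using that G.pair_sym_arcs by (auto simp: symmetric_def sym_def)
  have symH: "(v, u) \<in> parcs H" if "(u, v) \<in> parcs H" for u v
    using that H.pair_sym_arcs by (auto simp: symmetric_def sym_def)
  have sub: "parcs (G \<box> H) \<subseteq> pverts (G \<box> H) \<times> pverts (G \<box> H)"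
    by (auto simp: cartesian_product_def dest: G.wellformed' H.wellformed')
  have fin: "finite (pverts (G \<box> H))"
    by (simp add: cartesian_product_def G.pair_finite_verts H.pair_finite_verts)
  show ?thesis
  proof
    show "finite (parcs (G \<box> H))"
      using sub fin by (meson finite_SigmaI finite_subset)
    show "symmetric (with_proj (G \<box> H))"
      by (auto simp: cartesian_product_def symmetric_def sym_def intro: symG symH)
    show "fst e \<noteq> snd e" if "e \<in> parcs (G \<box> H)" for e
      using that by (auto simp: cartesian_product_def dest: G.no_loops' H.no_loops')
  qed (use sub fin in auto)
qed

text \<open>
  The positions of \<open>k\<close> cops form a list of length \<open>k\<close>, whose \<open>i\<close>-th entry is the vertex of the
  \<open>i\<close>-th cop.
\<close>

definition cop_move :: "'a pair_pre_digraph \<Rightarrow> 'a list \<Rightarrow> 'a list \<Rightarrow> bool" where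
  "cop_move G = list_all2 (\<lambda>u v. u = v \<or> (u, v) \<in> parcs G)"

definition robber_move :: "'a pair_pre_digraph \<Rightarrow> 'a set \<Rightarrow> 'a \<Rightarrow> 'a \<Rightarrow> bool" where
  "robber_move G C r r' \<longleftrightarrow>
    r' = r \<or> (\<exists>p. vpath p (with_proj G) \<and> hd p = r \<and> last p = r' \<and> set p \<inter> C = {})"

text \<open>
  A cop strategy \<open>\<sigma>\<close> maps the list of the robber's positions so far to the next positions of the
  cops: \<open>\<sigma> []\<close> is their initial placement, and \<open>\<sigma> [r\<^sub>0, \<dots>, r\<^sub>t]\<close> their placement after they respond
  to the robber standing at \<open>r\<^sub>t\<close>. The earlier cop positions are determined by \<open>\<sigma>\<close>, so this is a
  strategy depending on the full history of the game. Since a cop may always stay put, it does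
  no harm to demand legality also on histories that do not arise in a play.
\<close>

definition cop_strategy :: "'a pair_pre_digraph \<Rightarrow> nat \<Rightarrow> ('a list \<Rightarrow> 'a list) \<Rightarrow> bool" where
  "cop_strategy G k \<sigma> \<longleftrightarrow>
    length (\<sigma> []) = k \<and> set (\<sigma> []) \<subseteq> pverts G \<and>
    (\<forall>h r. cop_move G (\<sigma> h) (\<sigma> (h @ [r])))"

definition cop_position :: "('a list \<Rightarrow> 'a list) \<Rightarrow> (nat \<Rightarrow> 'a) \<Rightarrow> nat \<Rightarrow> 'a list" where
  "cop_position \<sigma> R t = \<sigma> (map R [0..<t])"

text \<open>
  With the robber at \<open>R t\<close>, the cops stand at \<open>cop_position \<sigma> R t\<close> before their turn and at
  \<open>cop_position \<sigma> R (Suc t)\<close> after it.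
\<close>

definition captured :: "('a list \<Rightarrow> 'a list) \<Rightarrow> (nat \<Rightarrow> 'a) \<Rightarrow> nat \<Rightarrow> bool" where
  "captured \<sigma> R t \<longleftrightarrow>
    R t \<in> set (cop_position \<sigma> R t) \<or> R t \<in> set (cop_position \<sigma> R (Suc t))"

text \<open>The game ends at the first capture, so the values of \<open>R\<close> after that are irrelevant.\<close>

definition robber_play :: "'a pair_pre_digraph \<Rightarrow> ('a list \<Rightarrow> 'a list) \<Rightarrow> (nat \<Rightarrow> 'a) \<Rightarrow> bool" where
  "robber_play G \<sigma> R \<longleftrightarrow>
    R 0 \<in> pverts G \<and>
    (\<forall>t. (\<forall>s\<le>t. \<not> captured \<sigma> R s) \<longrightarrow>
      robber_move G (set (cop_position \<sigma> R (Suc t))) (R t) (R (Suc t)))"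

definition cops_win :: "'a pair_pre_digraph \<Rightarrow> nat \<Rightarrow> bool" where
  "cops_win G k \<longleftrightarrow>
    (\<exists>\<sigma>. cop_strategy G k \<sigma> \<and> (\<forall>R. robber_play G \<sigma> R \<longrightarrow> (\<exists>t. captured \<sigma> R t)))"

definition cop_number_inf :: "'a pair_pre_digraph \<Rightarrow> nat" where
  "cop_number_inf G = (LEAST k. cops_win G k)"

text \<open>The minimum is attained for finite graphs.\<close>

lemma cops_win_cop_number_inf:
  assumes "finite (pverts G)"
  shows "cops_win G (cop_number_inf G)"
proof -
  obtain xs where xs: "set xs = pverts G"
    using assms finite_list by blast
  have "cop_strategy G (length xs) (\<lambda>_. xs)"
    by (auto simp: cop_strategy_def cop_move_def xs list_all2_same)
  moreover have "captured (\<lambda>_. xs) R 0" if "robber_play G (\<lambda>_. xs) R" for R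
    using that by (auto simp: captured_def cop_position_def robber_play_def xs)
  ultimately have "cops_win G (length xs)"
    unfolding cops_win_def by blast
  then show ?thesis
    unfolding cop_number_inf_def by (rule LeastI)
qed

end

theory Submission
  imports Defs
begin

text \<open>
  The layers \<open>x + y + z = s\<close> of the cubical grid are separators, and moving them from \<open>s = 0\<close>
  to \<open>s = 3 (n - 1)\<close> sweeps the whole grid. If at time \<open>s\<close> every vertex of layer \<open>s\<close> carries
  a cop, then a robber who starts above layer \<open>0\<close> can never get below the current layer: he is
  caught if he stands on the layer that the cops enter, and he cannot cross it otherwise, because
  the layer index changes by at most one along an edge. Every unit of time pushes him one layer
  higher, so he is caught eventually (\<open>cops_win_by_sweep\<close>).

  The cops have to cover all layers while moving only along edges. A chain of vertices whose layer
  index grows by one in each step serves this purpose: one cop waits at its bottom until the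
  sweep arrives, climbs with it, and remains at its top. So a partition of the grid into such
  chains gives a winning strategy with one cop per chain. A rectangular grid splits into
  hooks (\<open>hook_covers\<close>), where hook \<open>k\<close> runs right along row \<open>k\<close> and then up a column. Doing this
  once in the first two coordinates gives, for each \<open>j < n\<close>, a chain with \<open>2 (n - 1 - j) + 1\<close>
  elements; doing it again in the product of that chain with the third coordinate gives
  \<open>min (2 (n - 1 - j) + 1) n\<close> chains. These are the symmetric chains of de Bruijn, Tengbergen
  and Kruyswijk. Summing over \<open>j\<close>, about half of the terms equal \<open>n\<close> and the others are the odd
  numbers below \<open>n\<close>, which amounts to \<open>n\<^sup>2 / 2 + n\<^sup>2 / 4\<close> up to a constant.
\<close>

section \<open>Sweeping a graph layer by layer\<close>

text \<open>
  An arc lowers the layer by at most one, so a walk starting above layer \<open>s\<close> would have to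
  visit layer \<open>s\<close> in order to get below it.
\<close>

lemma vwalk_stays_above_layer:
  fixes \<rho> :: "'a \<Rightarrow> nat"
  assumes "vwalk p (with_proj G)"
    and "\<And>u v. (u, v) \<in> parcs G \<Longrightarrow> \<rho> u \<le> Suc (\<rho> v)"
    and "\<forall>v\<in>set p. \<rho> v \<noteq> s"
    and "s < \<rho> (hd p)"
  shows "s < \<rho> (last p)"
  using assms(1,3,4)
proof (induction p rule: vwalk_induct)
  case (Base u)
  then show ?case by simp
next
  case (Cons u v es)
  have "\<rho> u \<le> Suc (\<rho> v)"
    using Cons.hyps assms(2) by simp
  moreover have "\<rho> v \<noteq> s" "s < \<rho> u"
    using Cons.prems by simp_all
  ultimately show ?case
    using Cons.IH Cons.prems by simp
qed

text \<open>
  Cop \<open>i\<close> follows the timetable \<open>w i\<close> without looking at the robber, so the history enters the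
  strategy only through its length. The covering condition says that at time \<open>s\<close> the whole layer
  \<open>s\<close> is occupied.
\<close>

lemma cops_win_by_sweep:
  fixes \<rho> :: "'a \<Rightarrow> nat" and w :: "'i \<Rightarrow> nat \<Rightarrow> 'a"
  assumes fin_verts: "finite (pverts G)"
    and layers: "\<And>u v. (u, v) \<in> parcs G \<Longrightarrow> \<rho> u \<le> Suc (\<rho> v)"
    and fin: "finite I"
    and start: "\<And>i. i \<in> I \<Longrightarrow> w i 0 \<in> pverts G"
    and step: "\<And>i s. i \<in> I \<Longrightarrow> w i (Suc s) = w i s \<or> (w i s, w i (Suc s)) \<in> parcs G"
    and cover: "\<And>v. v \<in> pverts G \<Longrightarrow> \<exists>i\<in>I. w i (\<rho> v) = v"
  shows "cops_win G (card I)"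
proof -
  obtain xs where xs: "set xs = I" "distinct xs"
    using fin finite_distinct_list by blast
  define \<sigma> where "\<sigma> h = map (\<lambda>i. w i (length h)) xs" for h :: "'a list"
  have "cop_strategy G (card I) \<sigma>"
    using start step xs
    by (auto simp: cop_strategy_def \<sigma>_def cop_move_def distinct_card list_all2_map1
        list_all2_map2 list_all2_same) metis
  moreover have "\<exists>t. captured \<sigma> R t" if play: "robber_play G \<sigma> R" for R
  proof (rule ccontr)
    assume "\<nexists>t. captured \<sigma> R t"
    then have free: "\<not> captured \<sigma> R t" for t
      by blast
    have occupied: "v \<in> set (cop_position \<sigma> R (\<rho> v))" if "v \<in> pverts G" for v
      using cover[OF that] xs(1) by (force simp: cop_position_def \<sigma>_def)
    have above: "R t \<in> pverts G \<and> t < \<rho> (R t)" for t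
    proof (induction t)
      case 0
      have "R 0 \<in> pverts G"
        using play by (simp add: robber_play_def)
      moreover from this have "\<rho> (R 0) \<noteq> 0"
        using occupied[of "R 0"] free[of 0] by (metis captured_def)
      ultimately show ?case by simp
    next
      case (Suc t)
      have "\<rho> (R t) \<noteq> Suc t"
        using Suc occupied[of "R t"] free[of t] by (auto simp: captured_def)
      with Suc have high: "Suc t < \<rho> (R t)"
        by simp
      have "robber_move G (set (cop_position \<sigma> R (Suc t))) (R t) (R (Suc t))"
        using play free by (simp add: robber_play_def)
      then consider "R (Suc t) = R t"
        | p where "vwalk p (with_proj G)" "hd p = R t" "last p = R (Suc t)"
          "set p \<inter> set (cop_position \<sigma> R (Suc t)) = {}"
        by (auto simp: robber_move_def vpath_def)
      then show ?case
      proof cases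
        case 1
        with Suc high show ?thesis by simp
      next
        case (2 p)
        have sub: "set p \<subseteq> pverts G" and ne: "p \<noteq> []"
          using 2(1) by (auto simp: vwalk_def)
        have "\<forall>v\<in>set p. \<rho> v \<noteq> Suc t"
          using sub occupied 2(4) by fastforce
        then have "Suc t < \<rho> (last p)"
          using vwalk_stays_above_layer[OF 2(1) layers] high 2(2) by simp
        with 2(3) sub ne show ?thesis
          using last_in_set by fastforce
      qed
    qed
    \<comment> \<open>The layer of the robber grows without bound, but there are finitely many layers.\<close>
    have "\<rho> (R (Max (\<rho> ` pverts G))) \<le> Max (\<rho> ` pverts G)"
      using above fin_verts by (intro Max_ge) auto
    with above show False
      using leD by blast
  qed
  ultimately show ?thesis
    unfolding cops_win_def by blast
qed

section \<open>Splitting a rectangle into hooks\<close>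

text \<open>
  The \<open>k\<close>-th hook of \<open>{0..M} \<times> {0..N}\<close> runs from \<open>(0, k)\<close> to \<open>(M - k, k)\<close> and then to
  \<open>(M - k, N)\<close>. After \<open>u\<close> steps a cop who starts at its lower end is at \<open>hook M N k u\<close>; the
  outer \<open>min N\<close> makes her stay at the upper end.
\<close>

definition hook :: "nat \<Rightarrow> nat \<Rightarrow> nat \<Rightarrow> nat \<Rightarrow> nat \<times> nat" where
  "hook M N k u = (min u (M - k), min N (k + (u - (M - k))))"

lemma hook_in_rectangle: "hook M N k u \<in> {..M} \<times> {..N}"
  by (auto simp: hook_def)

lemma hook_Suc:
  assumes "k \<le> N"
  obtains "hook M N k (Suc u) = hook M N k u"
    | "hook M N k (Suc u) = map_prod Suc id (hook M N k u)"
    | "hook M N k (Suc u) = map_prod id Suc (hook M N k u)"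
proof -
  consider "u < M - k" | "M - k \<le> u" "k + (u - (M - k)) < N" | "M - k \<le> u" "N \<le> k + (u - (M - k))"
    by linarith
  then show thesis
    by cases (use assms that in \<open>auto simp: hook_def min_def Suc_diff_le\<close>)
qed

text \<open>
  Points on or below the antidiagonal \<open>a + b = M\<close> lie on the horizontal part of hook \<open>b\<close>, the
  others on the vertical part of hook \<open>M - a\<close>. The bound on \<open>a + b - k\<close> is the number of steps
  in the hook; it is what allows a hook to be used in turn as the side of a rectangle.
\<close>

lemma hook_covers:
  assumes "a \<le> M" and "b \<le> N"
  obtains k where "k \<le> M" "k \<le> N" "k \<le> a + b" "a + b - k \<le> M + N - 2 * k"
    "hook M N k (a + b - k) = (a, b)"
proof (cases "a + b \<le> M")
  case True
  with assms show thesis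
    by (intro that[of b]) (auto simp: hook_def)
next
  case False
  with assms show thesis
    by (intro that[of "M - a"]) (auto simp: hook_def)
qed

section \<open>A chain partition of the cubical grid\<close>

text \<open>
  Hook \<open>j\<close> of the first two coordinates has \<open>2 (n - 1 - j)\<close> edges and starts in layer \<open>j\<close>. Its
  product with the third coordinate is a rectangle, whose \<open>k\<close>-th hook starts at height \<open>k\<close>, hence
  in layer \<open>j + k\<close>. Truncated subtraction makes the cop wait at the start until the sweep gets there.
\<close>

definition chain_position :: "nat \<Rightarrow> nat \<times> nat \<Rightarrow> nat \<Rightarrow> (nat \<times> nat) \<times> nat" where
  "chain_position n = (\<lambda>(j, k) s.
    map_prod (hook (n - 1) (n - 1) j) id (hook (2 * (n - 1 - j)) (n - 1) k (s - (j + k))))"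

definition chain_indices :: "nat \<Rightarrow> (nat \<times> nat) set" where
  "chain_indices n = Sigma {..<n} (\<lambda>j. {..<min (2 * (n - 1 - j) + 1) n})"

lemma pverts_cube:
  "pverts (path_graph n \<box> path_graph n \<box> path_graph n) = ({..<n} \<times> {..<n}) \<times> {..<n}"
  by (simp add: cartesian_product_def path_graph_def)

lemma arcs_cube:
  shows "Suc x < n \<Longrightarrow> y < n \<Longrightarrow> z < n \<Longrightarrow>
      (((x, y), z), ((Suc x, y), z)) \<in> parcs (path_graph n \<box> path_graph n \<box> path_graph n)"
    and "x < n \<Longrightarrow> Suc y < n \<Longrightarrow> z < n \<Longrightarrow>
      (((x, y), z), ((x, Suc y), z)) \<in> parcs (path_graph n \<box> path_graph n \<box> path_graph n)"
    and "x < n \<Longrightarrow> y < n \<Longrightarrow> Suc z < n \<Longrightarrow>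
      (((x, y), z), ((x, y), Suc z)) \<in> parcs (path_graph n \<box> path_graph n \<box> path_graph n)"
  by (simp_all add: cartesian_product_def path_graph_def)

lemma chain_position_in_cube:
  assumes "i \<in> chain_indices n"
  shows "chain_position n i s \<in> ({..<n} \<times> {..<n}) \<times> {..<n}"
proof -
  obtain j k where i: "i = (j, k)" by force
  obtain t z where tz: "hook (2 * (n - 1 - j)) (n - 1) k (s - (j + k)) = (t, z)" by force
  have "z \<le> n - 1"
    using hook_in_rectangle[of "2 * (n - 1 - j)" "n - 1" k "s - (j + k)"] tz by simp
  moreover have "0 < n"
    using assms by (auto simp: chain_indices_def)
  ultimately show ?thesis
    using hook_in_rectangle[of "n - 1" "n - 1" j t] tz
    by (auto simp: chain_position_def i)
qed

lemma chain_position_step: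
  assumes "i \<in> chain_indices n"
  shows "chain_position n i (Suc s) = chain_position n i s \<or>
    (chain_position n i s, chain_position n i (Suc s))
      \<in> parcs (path_graph n \<box> path_graph n \<box> path_graph n)"
proof -
  obtain j k where i: "i = (j, k)" by force
  with assms have j: "j \<le> n - 1" and k: "k \<le> n - 1"
    by (auto simp: chain_indices_def)
  let ?H = "hook (2 * (n - 1 - j)) (n - 1) k"
  let ?B = "hook (n - 1) (n - 1) j"
  show ?thesis
  proof (cases "s < j + k")
    case True
    then show ?thesis by (simp add: chain_position_def i)
  next
    case False
    define u where "u = s - (j + k)"
    have u: "Suc s - (j + k) = Suc u"
      using False by (simp add: u_def Suc_diff_le)
    obtain t z where tz: "?H u = (t, z)" by force
    have now: "chain_position n i s = (?B t, z)"
      by (simp only: chain_position_def i prod.case u_def[symmetric] tz map_prod_simp id_apply)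
    have later: "chain_position n i (Suc s) = map_prod ?B id (?H (Suc u))"
      by (simp only: chain_position_def i prod.case u)
    obtain x y where xy: "?B t = (x, y)" by force
    note inside = chain_position_in_cube[OF assms, of "Suc s"]
      chain_position_in_cube[OF assms, of s, unfolded now xy]
    from k show ?thesis
    proof (cases rule: hook_Suc[of k "n - 1" "2 * (n - 1 - j)" u])
      case 1
      then have "chain_position n i (Suc s) = chain_position n i s"
        unfolding now later by (simp only: tz map_prod_simp id_apply)
      then show ?thesis ..
    next
      case 2
      then have later': "chain_position n i (Suc s) = (?B (Suc t), z)"
        unfolding later by (simp only: tz map_prod_simp id_apply)
      from j show ?thesis
      proof (cases rule: hook_Suc[of j "n - 1" "n - 1" t])
        case 1
        then show ?thesis unfolding now later' by simp
      next
        case 2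
        then have later'': "chain_position n i (Suc s) = ((Suc x, y), z)"
          unfolding later' by (simp only: xy map_prod_simp id_apply)
        show ?thesis
          using inside unfolding now xy later'' by (simp add: arcs_cube)
      next
        case 3
        then have later'': "chain_position n i (Suc s) = ((x, Suc y), z)"
          unfolding later' by (simp only: xy map_prod_simp id_apply)
        show ?thesis
          using inside unfolding now xy later'' by (simp add: arcs_cube)
      qed
    next
      case 3
      then have later': "chain_position n i (Suc s) = ((x, y), Suc z)"
        unfolding later by (simp only: tz xy map_prod_simp id_apply)
      show ?thesis
        using inside unfolding now xy later' by (simp add: arcs_cube)
    qed
  qed
qed

lemma chain_position_covers:
  assumes "x < n" "y < n" "z < n"
  shows "\<exists>i\<in>chain_indices n. chain_position n i (x + y + z) = ((x, y), z)"
proof -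
  obtain j where j: "j \<le> n - 1" "j \<le> x + y" "x + y - j \<le> 2 * (n - 1 - j)"
      "hook (n - 1) (n - 1) j (x + y - j) = (x, y)"
    using hook_covers[of x "n - 1" y "n - 1"] assms
    by (metis (no_types, lifting) Suc_pred' diff_mult_distrib2 less_Suc_eq_le mult_2
        not_less_zero not_gr_zero)
  obtain k where k: "k \<le> 2 * (n - 1 - j)" "k \<le> n - 1" "k \<le> x + y - j + z"
      "hook (2 * (n - 1 - j)) (n - 1) k (x + y - j + z - k) = (x + y - j, z)"
    using hook_covers[of "x + y - j" "2 * (n - 1 - j)" z "n - 1"] j(3) assms
    by (metis Suc_pred' less_Suc_eq_le not_less_zero not_gr_zero)
  have "x + y + z - (j + k) = x + y - j + z - k"
    using j(2) by simp
  then have "chain_position n (j, k) (x + y + z) = ((x, y), z)"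
    by (simp only: chain_position_def prod.case k(4) j(4) map_prod_simp id_apply)
  moreover have "(j, k) \<in> chain_indices n"
    using assms j k by (auto simp: chain_indices_def)
  ultimately show ?thesis by blast
qed

text \<open>
  In increasing order, the first \<open>n div 2\<close> summands are consecutive odd numbers with sum
  \<open>(n div 2)\<^sup>2\<close>; the others are at most \<open>n\<close>. With \<open>h = n div 2\<close>, completing the square in \<open>4 h\<^sup>2 + 4 (n - h) n\<close> gives
  \<open>(n - 2 h)\<^sup>2 + 3 n\<^sup>2\<close>.
\<close>

lemma card_chain_indices: "4 * card (chain_indices n) \<le> 3 * n\<^sup>2 + 1"
proof -
  define h where "h = n div 2"
  have h: "h \<le> n" by (simp add: h_def)
  have odds: "(\<Sum>j<m. 2 * j + 1) = m\<^sup>2" for m :: nat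
    by (induction m) (auto simp: power2_eq_square)
  have "card (chain_indices n) = (\<Sum>j<n. min (2 * (n - 1 - j) + 1) n)"
    by (simp add: chain_indices_def)
  also have "\<dots> = (\<Sum>j<n. min (2 * j + 1) n)"
    using sum.nat_diff_reindex[of "\<lambda>j. min (2 * j + 1) n" n] by simp
  also have "\<dots> = (\<Sum>j<h. min (2 * j + 1) n) + (\<Sum>j=h..<n. min (2 * j + 1) n)"
    using h by (metis atLeast0LessThan sum.atLeastLessThan_concat zero_le)
  also have "\<dots> \<le> (\<Sum>j<h. 2 * j + 1) + (\<Sum>j=h..<n. n)"
    by (intro add_mono sum_mono) auto
  also have "\<dots> = h\<^sup>2 + (n - h) * n"
    using odds by simp
  finally have *: "card (chain_indices n) \<le> h\<^sup>2 + (n - h) * n" .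
  have "4 * (h\<^sup>2 + (n - h) * n) \<le> 3 * n\<^sup>2 + 1"
  proof (cases "even n")
    case True
    then have "n = 2 * h" by (simp add: h_def)
    then show ?thesis by (simp add: power2_eq_square)
  next
    case False
    then have "n = Suc (2 * h)" by (simp add: h_def)
    then show ?thesis by (simp add: power2_eq_square algebra_simps)
  qed
  with mult_le_mono2[OF *, of 4] show ?thesis by (rule le_trans)
qed

section \<open>The bound for the cubical grid\<close>

lemma cops_win_cube:
  "cops_win (path_graph n \<box> path_graph n \<box> path_graph n) (card (chain_indices n))"
proof (rule cops_win_by_sweep[where w = "chain_position n" and \<rho> = "\<lambda>((x, y), z). x + y + z"])
  fix v assume "v \<in> pverts (path_graph n \<box> path_graph n \<box> path_graph n)"
  then show "\<exists>i\<in>chain_indices n. chain_position n i ((\<lambda>((x, y), z). x + y + z) v) = v"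
    using chain_position_covers by (auto simp: pverts_cube)
next
  show "finite (chain_indices n)"
    by (simp add: chain_indices_def)
next
  show "chain_position n i 0 \<in> pverts (path_graph n \<box> path_graph n \<box> path_graph n)"
    if "i \<in> chain_indices n" for i
    using chain_position_in_cube[OF that] by (simp add: pverts_cube)
next
  show "(\<lambda>((x, y), z). x + y + z) u \<le> Suc ((\<lambda>((x, y), z). x + y + z) v)"
    if "(u, v) \<in> parcs (path_graph n \<box> path_graph n \<box> path_graph n)" for u v
  proof -
    obtain x y z x' y' z' where "u = ((x, y), z)" "v = ((x', y'), z')"
      by (metis surj_pair)
    with that show ?thesis
      by (simp add: cartesian_product_def path_graph_def) linarith
  qed
qed (simp_all add: chain_position_step pverts_cube)

theorem theorem3p1:
  shows "\<exists>\<epsilon> :: nat \<Rightarrow> real. \<epsilon> \<longlonglongrightarrow> 0 \<and>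
    (\<forall>n\<ge>1. real (cop_number_inf (path_graph n \<box> path_graph n \<box> path_graph n))
      \<le> (0.75 + \<epsilon> n) * (real n)\<^sup>2)"
proof (intro exI conjI allI impI)
  show "(\<lambda>n. 1 / 4 * (inverse (real n))\<^sup>2) \<longlonglongrightarrow> 0"
    by (auto intro!: tendsto_mult_right_zero tendsto_null_power lim_inverse_n)
next
  fix n :: nat assume n: "1 \<le> n"
  have "cop_number_inf (path_graph n \<box> path_graph n \<box> path_graph n) \<le> card (chain_indices n)"
    unfolding cop_number_inf_def using cops_win_cube by (rule Least_le)
  then have "4 * cop_number_inf (path_graph n \<box> path_graph n \<box> path_graph n) \<le> 3 * n\<^sup>2 + 1"
    using card_chain_indices[of n] by linarith
  then have "4 * real (cop_number_inf (path_graph n \<box> path_graph n \<box> path_graph n))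
      \<le> 3 * (real n)\<^sup>2 + 1"
    by (metis (mono_tags, lifting) of_nat_1 of_nat_add of_nat_le_iff of_nat_mult of_nat_numeral
        of_nat_power)
  then have "real (cop_number_inf (path_graph n \<box> path_graph n \<box> path_graph n))
      \<le> (3 * (real n)\<^sup>2 + 1) / 4"
    by (simp add: field_simps)
  also have "(3 * (real n)\<^sup>2 + 1) / 4 = (0.75 + 1 / 4 * (inverse (real n))\<^sup>2) * (real n)\<^sup>2"
    using n by (simp add: field_simps)
  finally show "real (cop_number_inf (path_graph n \<box> path_graph n \<box> path_graph n))
      \<le> (0.75 + 1 / 4 * (inverse (real n))\<^sup>2) * (real n)\<^sup>2" .
qed

end
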